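(* Let $G$ be an R-sequenceable finite group of order $n$ and let $k\ge 2$ be an integer. Then there exists a sequence ${\bf p}: p_0,\ldots,p_{kn-1}$ in $G$ with $p_0=p_{kn-1}=1_G$ such that every element of $G$ appears exactly $k$ times in each of ${\bf p}$ and ${\bf \bar p}$.
   Context: All groups are finite; $1_G$ denotes the identity of a group $G$. For a sequence ${\bf g}: g_0,\ldots,g_m$ in a group $G$ with $g_0=1_G$, the sequence of consecutive quotients ${\bf \bar g}:\bar g_0,\ldots,\bar g_m$ is defined by $\bar g_0=1_G$ and $\bar g_i=g_{i-1}^{-1}g_i$ for $1\le i\le m$. A finite group $G$ of order $n$ is R-sequenceable if there exists a permutation $g_1,\ldots,g_{n-1}$ of the non-identity elements of $G$ such that the consecutive quotients $g_1^{-1}g_2,\ g_2^{-1}g_3,\ \ldots,\ g_{n-2}^{-1}g_{n-1},\ g_{n-1}^{-1}g_1$ also form a permutation of the non-identity elements of $G$. *)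

theory Defs
  imports "HOL-Algebra.Coset"
begin

definition consec_quot :: "('a, 'b) monoid_scheme \<Rightarrow> (nat \<Rightarrow> 'a) \<Rightarrow> nat \<Rightarrow> 'a" where
  "consec_quot G g i =
     (if i = 0 then \<one>\<^bsub>G\<^esub> else inv\<^bsub>G\<^esub> (g (i - 1)) \<otimes>\<^bsub>G\<^esub> g i)"

text \<open>The terms are indexed from 1 to n - 1, where n is the order of G, and the last quotient
  wraps around to the first term. The trivial group satisfies this vacuously.\<close>

definition R_sequenceable :: "('a, 'b) monoid_scheme \<Rightarrow> bool" where
  "R_sequenceable G \<longleftrightarrow>
     (\<exists>g :: nat \<Rightarrow> 'a.
        bij_betw g {1..order G - 1} (carrier G - {\<one>\<^bsub>G\<^esub>}) \<and>
        bij_betw (\<lambda>i. inv\<^bsub>G\<^esub> (g i) \<otimes>\<^bsub>G\<^esub> g (if i = order G - 1 then 1 else i + 1))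
          {1..order G - 1} (carrier G - {\<one>\<^bsub>G\<^esub>}))"

end

theory Submission
  imports Defs "HOL-Library.Multiset"
begin

text \<open>A sequence in \<open>G\<close> is a walk on the elements of \<open>G\<close> whose edges are labelled by consecutive
  quotients, and an R-sequencing is a closed walk \<open>C\<close> that meets every non-identity element once
  and uses every non-identity label once. The required sequence is found as an Eulerian circuit:
  choose a collection of closed walks with the right total numbers of vertices and labels, and
  splice them into a single walk wherever two of them meet.

  Fix \<open>x \<noteq> \<one>\<close>. The translate \<open>x C\<close> has the same labels as \<open>C\<close> but omits the vertex \<open>x\<close> instead
  of \<open>\<one>\<close>. Take \<open>k - 1\<close> copies of \<open>x C\<close>, one copy of \<open>C\<close>, and \<open>k - 1\<close> loops at \<open>x\<close>. The loops
  supply both the missing visits to \<open>x\<close> and the missing labels \<open>\<one>\<close>. In total every vertex is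
  visited \<open>k\<close> times, except \<open>\<one>\<close>, which is visited \<open>k - 1\<close> times; every label is used \<open>k\<close> times,
  except \<open>\<one>\<close>, which is used \<open>k - 1\<close> times. The trivial walk at \<open>\<one>\<close>, into which everything is
  spliced, contributes the last visit to \<open>\<one>\<close>, and the conventional quotient at index \<open>0\<close>
  contributes the last label \<open>\<one>\<close>.

  The pieces are connected: \<open>x C\<close> passes through \<open>\<one>\<close>, the loops sit at \<open>x\<close>, which lies on \<open>C\<close>,
  and \<open>C\<close> and \<open>x C\<close> share every vertex outside \<open>{\<one>, x}\<close>. Such a vertex exists because a group of
  order \<open>2\<close> is not R-sequenceable, its only candidate for \<open>C\<close> being a loop labelled \<open>\<one>\<close>.\<close>

section \<open>Quotients along walks\<close>

fun quots :: "('a, 'b) monoid_scheme \<Rightarrow> 'a list \<Rightarrow> 'a list" where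
  "quots G (a # b # xs) = (inv\<^bsub>G\<^esub> a \<otimes>\<^bsub>G\<^esub> b) # quots G (b # xs)"
| "quots G _ = []"

text \<open>A closed walk is represented by the list of its vertices, the starting vertex being listed
  only once; closing it up adds the quotient that wraps around.\<close>

definition cyclic_quots :: "('a, 'b) monoid_scheme \<Rightarrow> 'a list \<Rightarrow> 'a list" where
  "cyclic_quots G c = quots G (c @ [hd c])"

lemma length_quots: "length (quots G xs) = length xs - 1"
  by (induction G xs rule: quots.induct) auto

lemma nth_quots:
  "Suc i < length xs \<Longrightarrow> quots G xs ! i = inv\<^bsub>G\<^esub> (xs ! i) \<otimes>\<^bsub>G\<^esub> xs ! Suc i"
proof (induction G xs arbitrary: i rule: quots.induct)
  case (1 G a b xs)
  then show ?case by (cases i) auto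
qed auto

lemma quots_split: "quots G (xs @ v # ys) = quots G (xs @ [v]) @ quots G (v # ys)"
proof (induction xs)
  case (Cons a xs)
  then show ?case by (cases xs) auto
qed simp

text \<open>Starting a closed walk at another of its vertices \<open>v\<close> only swaps the two stretches into
  which \<open>v\<close> cuts it; a detour from \<open>v\<close> has to start there.\<close>

lemma mset_cyclic_quots_rotate:
  "mset (cyclic_quots G (xs @ v # ys)) = mset (quots G (v # ys @ xs @ [v]))"
proof (cases xs)
  case (Cons a zs)
  have "quots G (v # ys @ xs @ [v]) = quots G (v # ys @ [a]) @ quots G (a # zs @ [v])"
    using quots_split[of G "v # ys" a "zs @ [v]"] Cons by simp
  moreover have "cyclic_quots G (xs @ v # ys) = quots G (a # zs @ [v]) @ quots G (v # ys @ [a])"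
    using quots_split[of G "a # zs" v "ys @ [a]"] Cons by (simp add: cyclic_quots_def)
  ultimately show ?thesis by simp
qed (simp add: cyclic_quots_def)

text \<open>The translating element cancels in each quotient, so that all translates of an R-sequencing
  carry the same labels.\<close>

lemma (in group) quots_translate:
  assumes "x \<in> carrier G" "set xs \<subseteq> carrier G"
  shows "quots G (map (\<lambda>y. x \<otimes> y) xs) = quots G xs"
  using assms(2)
proof (induction xs rule: induct_list012)
  case (3 a b xs)
  have "inv x \<otimes> (x \<otimes> b) = b"
    using 3 assms(1) by (simp flip: m_assoc)
  then have "inv (x \<otimes> a) \<otimes> (x \<otimes> b) = inv a \<otimes> b"
    using 3 assms(1) by (simp add: inv_mult_group m_assoc)
  then show ?case using 3 by simp
qed auto

lemma (in group) cyclic_quots_translate: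
  assumes "x \<in> carrier G" "set c \<subseteq> carrier G" "c \<noteq> []"
  shows "cyclic_quots G (map (\<lambda>y. x \<otimes> y) c) = cyclic_quots G c"
proof -
  have "set (c @ [hd c]) \<subseteq> carrier G"
    using assms(2,3) hd_in_set[of c] by auto
  from quots_translate[OF assms(1) this] show ?thesis
    using assms(3) by (simp add: cyclic_quots_def hd_map)
qed

section \<open>Splicing closed walks\<close>

text \<open>At a common vertex \<open>v\<close>, a walk can make a detour once around a closed walk, started at \<open>v\<close>.
  This keeps its endpoints and adds up the vertices and the quotients.\<close>

lemma splice_closed_walk:
  assumes "v \<in> set p" "v \<in> set c"
  obtains p' where "hd p' = hd p" "last p' = last p" "mset p' = mset p + mset c"
    "mset (quots G p') = mset (quots G p) + mset (cyclic_quots G c)"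
proof -
  obtain as bs where p: "p = as @ v # bs" using assms(1) by (meson split_list)
  obtain xs ys where c: "c = xs @ v # ys" using assms(2) by (meson split_list)
  define p' where "p' = as @ v # (ys @ xs) @ v # bs"
  have "quots G p' = quots G (as @ [v]) @ quots G (v # (ys @ xs) @ [v]) @ quots G (v # bs)"
    using quots_split[of G as v "(ys @ xs) @ v # bs"] quots_split[of G "v # ys @ xs" v bs]
    by (simp add: p'_def)
  moreover have "quots G p = quots G (as @ [v]) @ quots G (v # bs)"
    by (simp add: p quots_split[of G as v bs])
  ultimately have "mset (quots G p') = mset (quots G p) + mset (cyclic_quots G c)"
    by (simp add: c mset_cyclic_quots_rotate)
  moreover have "hd p' = hd p" "last p' = last p" "mset p' = mset p + mset c"
    by (auto simp: p'_def p c hd_append)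
  ultimately show ?thesis using that by blast
qed

lemma set_mset_repeat_mset: "j > 0 \<Longrightarrow> set_mset (repeat_mset j M) = set_mset M"
  by (intro Set.set_eqI) (simp flip: count_greater_zero_iff)

lemma splice_closed_walk_repeatedly:
  assumes "v \<in> set p" "v \<in> set c"
  obtains p' where "hd p' = hd p" "last p' = last p"
    "mset p' = mset p + repeat_mset j (mset c)"
    "mset (quots G p') = mset (quots G p) + repeat_mset j (mset (cyclic_quots G c))"
proof -
  have "\<exists>p'. hd p' = hd p \<and> last p' = last p \<and> mset p' = mset p + repeat_mset j (mset c) \<and>
      mset (quots G p') = mset (quots G p) + repeat_mset j (mset (cyclic_quots G c))"
  proof (induction j)
    case 0
    show ?case by auto
  next
    case (Suc j)
    then obtain q where q: "hd q = hd p" "last q = last p"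
      "mset q = mset p + repeat_mset j (mset c)"
      "mset (quots G q) = mset (quots G p) + repeat_mset j (mset (cyclic_quots G c))"
      by blast
    have "v \<in># mset q" using assms(1) q(3) by simp
    then have "v \<in> set q" by simp
    then obtain p' where "hd p' = hd q" "last p' = last q" "mset p' = mset q + mset c"
      "mset (quots G p') = mset (quots G q) + mset (cyclic_quots G c)"
      using splice_closed_walk assms(2) by metis
    with q show ?case by (intro exI[of _ p']) simp
  qed
  then show ?thesis using that by blast
qed

section \<open>Assembling the circuit\<close>

lemma R_sequenceable_closed_walk:
  assumes "finite (carrier G)" "R_sequenceable G"
  obtains c where "mset c = mset_set (carrier G - {\<one>\<^bsub>G\<^esub>})"
    "mset (cyclic_quots G c) = mset_set (carrier G - {\<one>\<^bsub>G\<^esub>})"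
proof -
  define m where "m = order G - 1"
  define q where "q g i = inv\<^bsub>G\<^esub> (g i) \<otimes>\<^bsub>G\<^esub> g (if i = m then 1 else i + 1)" for g i
  obtain g where g: "bij_betw g {1..m} (carrier G - {\<one>\<^bsub>G\<^esub>})"
    and q: "bij_betw (q g) {1..m} (carrier G - {\<one>\<^bsub>G\<^esub>})"
    using assms(2) unfolding R_sequenceable_def q_def m_def by blast
  have mset_map_bij: "mset (map f [1..<Suc m]) = mset_set (carrier G - {\<one>\<^bsub>G\<^esub>})"
    if "bij_betw f {1..m} (carrier G - {\<one>\<^bsub>G\<^esub>})" for f
    using that by (simp add: image_mset_mset_set bij_betw_def atLeastLessThanSuc_atLeastAtMost
        del: upt_Suc)
  define c where "c = map g [1..<Suc m]"
  have "cyclic_quots G c = map (q g) [1..<Suc m]"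
  proof (rule nth_equalityI)
    show "length (cyclic_quots G c) = length (map (q g) [1..<Suc m])"
      by (simp add: cyclic_quots_def length_quots c_def del: upt_Suc)
  next
    fix i assume "i < length (cyclic_quots G c)"
    then have i: "i < m" by (simp add: cyclic_quots_def length_quots c_def del: upt_Suc)
    then show "cyclic_quots G c ! i = map (q g) [1..<Suc m] ! i"
      by (cases "Suc i = m")
        (auto simp: cyclic_quots_def c_def nth_quots nth_append q_def hd_map hd_upt
          simp del: upt_Suc)
  qed
  then show ?thesis using that[of c] mset_map_bij[OF g] mset_map_bij[OF q] by (simp add: c_def)
qed

lemma (in group) R_sequenceable_circuit:
  assumes fin: "finite (carrier G)" and R: "R_sequenceable G" and "k \<ge> 2"
  obtains p where "hd p = \<one>" "last p = \<one>" "mset p = repeat_mset k (mset_set (carrier G))"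
    "mset (\<one> # quots G p) = repeat_mset k (mset_set (carrier G))"
proof (cases "carrier G = {\<one>}")
  case True
  \<comment> \<open>In the trivial group there is no \<open>x \<noteq> \<one>\<close>; loops at \<open>\<one>\<close> are enough.\<close>
  obtain p where p: "hd p = \<one>" "last p = \<one>" "mset p = {#\<one>#} + repeat_mset (k - 1) {#\<one>#}"
    "mset (quots G p) = repeat_mset (k - 1) {#\<one>#}"
    using splice_closed_walk_repeatedly[of "\<one>" "[\<one>]" "[\<one>]" "k - 1" G]
    by (auto simp: cyclic_quots_def)
  have "{#\<one>#} + repeat_mset (k - 1) {#\<one>#} = repeat_mset k {#\<one>#}"
    using \<open>k \<ge> 2\<close> by (intro multiset_eqI) auto
  then show ?thesis using that[of p] p True by simp
next
  case False
  let ?S = "carrier G"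
  obtain x where x: "x \<in> ?S" "x \<noteq> \<one>" using False one_closed by blast
  obtain c where c: "mset c = mset_set (?S - {\<one>})"
    and qc: "mset (cyclic_quots G c) = mset_set (?S - {\<one>})"
    using R_sequenceable_closed_walk[OF fin R] .
  have set_c: "set c = ?S - {\<one>}" using arg_cong[OF c, of set_mset] fin by simp
  have "x \<in> set c" using set_c x by simp
  then have "c \<noteq> []" by auto
  have "?S \<noteq> {\<one>, x}"
  proof
    assume S: "?S = {\<one>, x}"
    have "?S - {\<one>} = {x}" unfolding S using x(2) by blast
    then have "mset c = {#x#}" "mset (cyclic_quots G c) = {#x#}"
      using c qc by simp_all
    then have "c = [x]" "mset (cyclic_quots G c) = {#x#}" by simp_all
    then show False using x by (simp add: cyclic_quots_def)
  qed
  then obtain w where w: "w \<in> ?S" "w \<noteq> \<one>" "w \<noteq> x" using x one_closed by blast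
  define d where "d = map (\<lambda>y. x \<otimes> y) c"
  have bij: "bij_betw (\<lambda>y. x \<otimes> y) (?S - {\<one>}) (?S - {x})"
  proof (rule bij_betwI[where g = "\<lambda>y. inv x \<otimes> y"])
    show "(\<lambda>y. x \<otimes> y) \<in> (?S - {\<one>}) \<rightarrow> (?S - {x})"
      using x by (auto simp: r_cancel_one)
    show "(\<lambda>y. inv x \<otimes> y) \<in> (?S - {x}) \<rightarrow> (?S - {\<one>})"
      using x by (auto simp: inv_solve_left')
  qed (use x in \<open>auto simp: m_assoc[symmetric]\<close>)
  have d: "mset d = mset_set (?S - {x})"
    using bij c by (simp add: d_def image_mset_mset_set bij_betw_def)
  have set_d: "set d = ?S - {x}" using arg_cong[OF d, of set_mset] fin by simp
  have qd: "mset (cyclic_quots G d) = mset_set (?S - {\<one>})"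
    using cyclic_quots_translate[of x c] x set_c \<open>c \<noteq> []\<close> qc by (auto simp: d_def)

  obtain p1 where p1: "hd p1 = \<one>" "last p1 = \<one>"
    "mset p1 = {#\<one>#} + repeat_mset (k - 1) (mset_set (?S - {x}))"
    "mset (quots G p1) = repeat_mset (k - 1) (mset_set (?S - {\<one>}))"
    using splice_closed_walk_repeatedly[of "\<one>" "[\<one>]" d "k - 1" G] set_d x d qd by auto
  \<comment> \<open>Here \<open>k \<ge> 2\<close> is essential: at least one copy of \<open>x C\<close> must link \<open>\<one>\<close> to \<open>C\<close>.\<close>
  have "w \<in># mset p1" using p1(3) w fin \<open>k \<ge> 2\<close> by (simp add: set_mset_repeat_mset)
  then have "w \<in> set p1" "w \<in> set c" using w set_c by auto
  then obtain p2 where p2: "hd p2 = \<one>" "last p2 = \<one>" "mset p2 = mset p1 + mset c"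
    "mset (quots G p2) = mset (quots G p1) + mset (cyclic_quots G c)"
    using splice_closed_walk[of w p1 c G] p1(1,2) by metis
  have "x \<in># mset p2" using p2(3) set_c x by simp
  then have "x \<in> set p2" by simp
  then obtain p where p: "hd p = \<one>" "last p = \<one>"
    "mset p = mset p2 + repeat_mset (k - 1) {#x#}"
    "mset (quots G p) = mset (quots G p2) + repeat_mset (k - 1) {#\<one>#}"
    using splice_closed_walk_repeatedly[of x p2 "[x]" "k - 1" G] p2(1,2) x
    by (auto simp: cyclic_quots_def)

  have "mset p = repeat_mset k (mset_set ?S)"
    using \<open>k \<ge> 2\<close> x fin
    by (intro multiset_eqI) (auto simp: p(3) p2(3) p1(3) c count_mset_set')
  moreover have "mset (\<one> # quots G p) = repeat_mset k (mset_set ?S)"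
    using \<open>k \<ge> 2\<close> fin
    by (intro multiset_eqI) (auto simp: p(4) p2(4) p1(4) qc count_mset_set')
  ultimately show ?thesis using that p(1,2) by blast
qed

section \<open>From lists to indexed sequences\<close>

lemma nth_quots_eq_consec_quot:
  "i < length p \<Longrightarrow> (\<one>\<^bsub>G\<^esub> # quots G p) ! i = consec_quot G (\<lambda>i. p ! i) i"
  by (cases i) (simp_all add: consec_quot_def nth_quots)

theorem lemma6:
  fixes G :: "('a, 'b) monoid_scheme" (structure) and n k :: nat
  assumes "group G" and "finite (carrier G)" and "order G = n"
    and "R_sequenceable G" and "k \<ge> 2"
  shows "\<exists>p :: nat \<Rightarrow> 'a.
           p \<in> {0..k * n - 1} \<rightarrow> carrier G \<and>
           p 0 = \<one> \<and> p (k * n - 1) = \<one> \<and>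
           (\<forall>x\<in>carrier G.
              card {i \<in> {0..k * n - 1}. p i = x} = k \<and>
              card {i \<in> {0..k * n - 1}. consec_quot G p i = x} = k)"
proof -
  interpret group G by fact
  obtain p where p: "hd p = \<one>" "last p = \<one>" "mset p = repeat_mset k (mset_set (carrier G))"
    and qp: "mset (\<one> # quots G p) = repeat_mset k (mset_set (carrier G))"
    using R_sequenceable_circuit[OF assms(2,4,5)] .
  have "n > 0" using assms(2,3) order_gt_0_iff_finite by blast
  have len: "length p = k * n"
    using arg_cong[OF p(3), of size] assms(3) by (simp add: order_def)
  then have "p \<noteq> []" using \<open>n > 0\<close> \<open>k \<ge> 2\<close> by auto
  then have indices: "{0..k * n - 1} = {..<length p}"
    using len by (auto simp: neq_Nil_conv)
  have set_p: "set p = carrier G"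
    using arg_cong[OF p(3), of set_mset] assms(2,5)
    by (simp add: set_mset_repeat_mset)
  have card_indices: "card {i \<in> {..<length xs}. xs ! i = x} = count (mset xs) x"
    for xs :: "'a list" and x
    by (simp add: count_mset count_list_eq_length_filter length_filter_conv_card
        eq_commute[of x])
  have card_p: "card {i \<in> {..<length p}. p ! i = x} = k" if "x \<in> carrier G" for x
    using that assms(2) unfolding card_indices p(3) by simp
  have card_quots: "card {i \<in> {..<length p}. consec_quot G (\<lambda>i. p ! i) i = x} = k"
    if "x \<in> carrier G" for x
  proof -
    have "length (\<one> # quots G p) = length p"
      using \<open>p \<noteq> []\<close> by (simp add: length_quots)
    then have "{i \<in> {..<length p}. consec_quot G (\<lambda>i. p ! i) i = x} =
        {i \<in> {..<length (\<one> # quots G p)}. (\<one> # quots G p) ! i = x}"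
      by (auto simp: nth_quots_eq_consec_quot)
    then have "card {i \<in> {..<length p}. consec_quot G (\<lambda>i. p ! i) i = x} =
        count (mset (\<one> # quots G p)) x"
      by (simp only: card_indices)
    then show ?thesis using that assms(2) unfolding qp by simp
  qed
  have ends: "p ! 0 = \<one>" "p ! (k * n - 1) = \<one>"
    using p(1,2) \<open>p \<noteq> []\<close> len by (simp_all add: hd_conv_nth last_conv_nth)
  have in_carrier: "p ! i \<in> carrier G" if "i \<in> {..<length p}" for i
    using that nth_mem[of i p] unfolding set_p lessThan_iff by blast
  show ?thesis
    unfolding indices
    by (intro exI[of _ "\<lambda>i. p ! i"] conjI ballI Pi_I in_carrier ends card_p card_quots)
qed

end
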